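(* Let $K\subset\mathbb R^2$ be an origin-symmetric convex body with boundary of class $C^2$, and let $\delta_*=\frac12\mathrm{Vol}_2(K)$. If $\Gamma_{\delta_*}(K)$ is homothetic to $\mathcal I^*K$, then $K$ is an ellipse.
   Context: A convex body is a compact convex set with non-empty interior. For each unit vector $\boldsymbol\xi$ let $H_{\boldsymbol\xi}$ be the line orthogonal to $\boldsymbol\xi$ such that the half-plane $H_{\boldsymbol\xi}^-$ cuts off from $K$ area exactly $\delta_*$ (for symmetric $K$ these are the lines through the origin); $\Gamma_{\delta_*}(K)$ is the locus of the centroids of $K\cap H_{\boldsymbol\xi}^-$. The intersection body $\mathcal IK$ of $K$ is the star body with radial function $\rho_{\mathcal IK}(\boldsymbol\xi)=\mathrm{Vol}_1(K\cap\boldsymbol\xi^\perp)$, and $\mathcal I^*K=(\mathcal IK)^*$ is its polar body, with support function $h_{\mathcal I^*K}=1/\rho_{\mathcal IK}$. Two curves/bodies are homothetic if one is the image of the other under a map $x\mapsto q+\lambda(x-q)$ with $\lambda>0$. *)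

theory Defs
  imports "HOL-Analysis.Analysis"
begin

definition convex_body :: "(real^2) set \<Rightarrow> bool" where
  "convex_body K \<longleftrightarrow> compact K \<and> convex K \<and> interior K \<noteq> {}"

definition origin_symmetric :: "(real^2) set \<Rightarrow> bool" where
  "origin_symmetric K \<longleftrightarrow> (\<forall>x\<in>K. - x \<in> K)"

definition rot90 :: "real^2 \<Rightarrow> real^2" where
  "rot90 u = vector [- (u$2), u$1]"

definition C2_fun :: "(real \<Rightarrow> real) \<Rightarrow> bool" where
  "C2_fun g \<longleftrightarrow> (\<exists>g' g''. (\<forall>t. (g has_real_derivative g' t) (at t) \<and>
        (g' has_real_derivative g'' t) (at t)) \<and> continuous_on UNIV g'')"

definition C2_boundary :: "(real^2) set \<Rightarrow> bool" where
  "C2_boundary K \<longleftrightarrow> (\<forall>p\<in>frontier K. \<exists>u U g. norm u = 1 \<and> open U \<and> p \<in> U \<and> C2_fun g \<and>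
      frontier K \<inter> U = {x\<in>U. x \<bullet> u = g (x \<bullet> rot90 u)})"

definition centroid :: "(real^2) set \<Rightarrow> real^2" where
  "centroid S = (1 / measure lebesgue S) *\<^sub>R integral S (\<lambda>x. x)"

definition Gamma :: "real \<Rightarrow> (real^2) set \<Rightarrow> (real^2) set" where
  "Gamma \<delta> K = {centroid (K \<inter> {x. x \<bullet> \<xi> \<le> t}) | \<xi> t.
       norm \<xi> = 1 \<and> measure lebesgue (K \<inter> {x. x \<bullet> \<xi> \<le> t}) = \<delta>}"

text \<open>Radial function of the intersection body: length of the chord K \<inter> xi^perp.\<close>
definition ib_radial :: "(real^2) set \<Rightarrow> real^2 \<Rightarrow> real" where
  "ib_radial K \<xi> = measure lebesgue {s::real. s *\<^sub>R rot90 \<xi> \<in> K}"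

definition intersection_body :: "(real^2) set \<Rightarrow> (real^2) set" where
  "intersection_body K = {r *\<^sub>R \<xi> | r \<xi>. norm \<xi> = 1 \<and> 0 \<le> r \<and> r \<le> ib_radial K \<xi>}"

definition polar_body :: "(real^2) set \<Rightarrow> (real^2) set" where
  "polar_body L = {y. \<forall>x\<in>L. x \<bullet> y \<le> 1}"

definition homothetic :: "(real^2) set \<Rightarrow> (real^2) set \<Rightarrow> bool" where
  "homothetic A B \<longleftrightarrow> (\<exists>q c. c > 0 \<and> B = (\<lambda>x. q + c *\<^sub>R (x - q)) ` A)"

definition is_ellipse :: "(real^2) set \<Rightarrow> bool" where
  "is_ellipse K \<longleftrightarrow> (\<exists>M::real^2^2. \<exists>c. invertible M \<and> K = (\<lambda>x. c + M *v x) ` cball 0 1)"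

end

theory Submission
  imports Defs
begin

text \<open>
  Since the first moment of \<open>K\<close> vanishes, the support function of \<open>\<Gamma>\<close> at \<open>x\<close> is the mean of
  \<open>\<bar>y \<bullet> x\<bar>\<close> over \<open>y \<in> K\<close>, while \<open>\<I>K\<close> is \<open>2K\<close> turned by a right angle. Central symmetry of both
  sides removes the centre of the homothety, so the hypothesis says that the gauge of \<open>K\<close> at \<open>x\<close> is
  a multiple of the integral of \<open>\<bar>y \<bullet> x\<^sup>\<bottom>\<bar>\<close> over \<open>y \<in> K\<close>, where \<open>x\<^sup>\<bottom>\<close> is \<open>x\<close> turned by a right
  angle. Let \<open>G s\<close> be the gauge at \<open>(1, s)\<close>. In the slope coordinates \<open>(a, a \<sigma>)\<close> this becomes
  \<open>G s = \<kappa> \<integral> \<bar>s - \<sigma>\<bar> / (G \<sigma>)\<^sup>3 d\<sigma>\<close>, whence \<open>G'' = 2\<kappa> / G\<^sup>3\<close>. Solutions of this Ermakov--Pinney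
  equation have a quadratic polynomial as square, so the squared gauge is a quadratic form.
\<close>

section \<open>The one-dimensional integral equation\<close>

text \<open>The second derivative of the square of \<open>G\<close> is 2 (G'^2 + k / G^2), twice the
  energy of the equation. The energy is constant, so two integrations leave a quadratic polynomial
  whose leading coefficient is the energy \<open>d\<close>.\<close>

lemma pinney_square_quadratic:
  fixes G G' :: "real \<Rightarrow> real"
  assumes G: "\<And>s. (G has_real_derivative G' s) (at s)"
    and G': "\<And>s. (G' has_real_derivative k / G s ^ 3) (at s)"
    and pos: "\<And>s. G s > 0"
  shows "\<exists>a b d. \<forall>s. (G s)\<^sup>2 = a + b * s + d * s\<^sup>2"
proof -
  have const: "\<exists>c. \<forall>s. f s = c" if "\<And>s. (f has_real_derivative 0) (at s)" for f :: "real \<Rightarrow> real"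
    using that by (metis DERIV_isconst_all)
  have nz: "G s \<noteq> 0" for s using pos[of s] by simp
  \<comment> \<open>conserved energy\<close>
  have "\<exists>d. \<forall>s. (G' s)\<^sup>2 + k / (G s)\<^sup>2 = d"
    by (rule const) (use nz in \<open>auto intro!: derivative_eq_intros G G' simp: field_simps eval_nat_numeral\<close>)
  then obtain d where d: "\<And>s. (G' s)\<^sup>2 + k / (G s)\<^sup>2 = d" by blast
  have "\<exists>b. \<forall>s. 2 * G s * G' s - 2 * d * s = b"
  proof (rule const)
    fix s
    have "((\<lambda>s. 2 * G s * G' s - 2 * d * s) has_real_derivative
        2 * ((G' s)\<^sup>2 + k / (G s)\<^sup>2) - 2 * d) (at s)"
      by (use nz in \<open>auto intro!: derivative_eq_intros G G' simp: field_simps eval_nat_numeral\<close>)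
    then show "((\<lambda>s. 2 * G s * G' s - 2 * d * s) has_real_derivative 0) (at s)"
      by (simp add: d)
  qed
  then obtain b where b: "\<And>s. 2 * G s * G' s - 2 * d * s = b" by blast
  have "\<exists>a. \<forall>s. (G s)\<^sup>2 - b * s - d * s\<^sup>2 = a"
  proof (rule const)
    fix s
    have "((\<lambda>s. (G s)\<^sup>2 - b * s - d * s\<^sup>2) has_real_derivative
        (2 * G s * G' s - 2 * d * s) - b) (at s)"
      by (auto intro!: derivative_eq_intros G G' simp: field_simps eval_nat_numeral)
    then show "((\<lambda>s. (G s)\<^sup>2 - b * s - d * s\<^sup>2) has_real_derivative 0) (at s)"
      by (simp add: b)
  qed
  then obtain a where a: "\<And>s. (G s)\<^sup>2 - b * s - d * s\<^sup>2 = a" by blast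
  have "(G s)\<^sup>2 = a + b * s + d * s\<^sup>2" for s
    using a[of s] by linarith
  then show ?thesis by blast
qed

text \<open>Differentiating \<bar>s - \<sigma>\<bar> twice in \<open>s\<close> gives, in the
  distributional sense, twice a point mass at \<sigma>. The proof realises this with ordinary
  derivatives.\<close>

lemma integral_abs_kernel_derivatives:
  fixes w G :: "real \<Rightarrow> real"
  assumes w: "continuous_on UNIV w" "\<And>\<sigma>. w \<sigma> \<ge> 0"
    and int: "\<And>s. integrable lborel (\<lambda>\<sigma>. \<bar>s - \<sigma>\<bar> * w \<sigma>)"
    and G: "\<And>s. G s = \<kappa> * (LINT \<sigma>|lborel. \<bar>s - \<sigma>\<bar> * w \<sigma>)"
  shows "(G has_real_derivative deriv G s) (at s)"
    and "(deriv G has_real_derivative 2 * \<kappa> * w s) (at s)"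
proof -
  have wm: "w \<in> borel_measurable borel"
    using w(1) by (rule borel_measurable_continuous_onI)
  \<comment> \<open>The weights \<bar>0 - \<sigma>\<bar> and \<bar>1 - \<sigma>\<bar> add up to at
    least 1, so two instances of \<open>int\<close> dominate \<open>w\<close>.\<close>
  have iw: "integrable lborel w"
  proof (rule Bochner_Integration.integrable_bound)
    show "integrable lborel (\<lambda>\<sigma>. \<bar>0 - \<sigma>\<bar> * w \<sigma> + \<bar>1 - \<sigma>\<bar> * w \<sigma>)"
      by (intro Bochner_Integration.integrable_add int)
    have "norm (w \<sigma>) \<le> norm (\<bar>0 - \<sigma>\<bar> * w \<sigma> + \<bar>1 - \<sigma>\<bar> * w \<sigma>)" for \<sigma>
    proof -
      have "1 * w \<sigma> \<le> (\<bar>0 - \<sigma>\<bar> + \<bar>1 - \<sigma>\<bar>) * w \<sigma>"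
        using w(2) by (intro mult_right_mono) auto
      then show ?thesis using w(2)[of \<sigma>] by (simp add: algebra_simps)
    qed
    then show "AE \<sigma> in lborel. norm (w \<sigma>) \<le> norm (\<bar>0 - \<sigma>\<bar> * w \<sigma> + \<bar>1 - \<sigma>\<bar> * w \<sigma>)"
      by simp
  qed (use wm in simp)
  have isw: "integrable lborel (\<lambda>\<sigma>. \<sigma> * w \<sigma>)"
    by (rule Bochner_Integration.integrable_bound[OF int[of 0]])
       (use wm w(2) in \<open>auto simp: abs_mult\<close>)
  \<comment> \<open>Splitting the kernel at a base point \<open>R\<close> leaves an affine function plus integrals over the
     compact interval \<open>{R..t}\<close>, to which the fundamental theorem of calculus applies.\<close>
  define D where "D R t = \<kappa> * (2 * (LINT \<sigma>:{..<R}|lborel. w \<sigma>) - (LINT \<sigma>|lborel. w \<sigma>)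
      + 2 * integral {R..t} w)" for R t
  have rep: "G t = \<kappa> * ((2 * (LINT \<sigma>:{..<R}|lborel. w \<sigma>) - (LINT \<sigma>|lborel. w \<sigma>)) * t
      + ((LINT \<sigma>|lborel. \<sigma> * w \<sigma>) - 2 * (LINT \<sigma>:{..<R}|lborel. \<sigma> * w \<sigma>))
      + 2 * (t * integral {R..t} w - integral {R..t} (\<lambda>\<sigma>. \<sigma> * w \<sigma>)))" if "R \<le> t" for R t
  proof -
    have i1: "set_integrable lborel A w" "set_integrable lborel A (\<lambda>\<sigma>. \<sigma> * w \<sigma>)"
      if "A \<in> sets borel" for A
      unfolding set_integrable_def using that iw isw by (intro integrable_mult_indicator; simp)+
    have e1: "integral {R..t} w = (LINT \<sigma>:{R..t}|lborel. w \<sigma>)"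
         "integral {R..t} (\<lambda>\<sigma>. \<sigma> * w \<sigma>) = (LINT \<sigma>:{R..t}|lborel. \<sigma> * w \<sigma>)"
      using set_borel_integral_eq_integral(2)[OF i1(1)[of "{R..t}"]]
         set_borel_integral_eq_integral(2)[OF i1(2)[of "{R..t}"]] by auto
    \<comment> \<open>\<bar>t - \<sigma>\<bar> is \<sigma> - t plus 2 (t - \<sigma>) on the
      half-line \<sigma> \<le> t, and that half-line is cut at \<open>R\<close>.\<close>
    have pt: "\<bar>t - \<sigma>\<bar> * w \<sigma> = \<sigma> * w \<sigma> - t * w \<sigma>
        + 2 * t * (indicat_real {..<R} \<sigma> * w \<sigma>) - 2 * (indicat_real {..<R} \<sigma> * (\<sigma> * w \<sigma>))
        + 2 * t * (indicat_real {R..t} \<sigma> * w \<sigma>) - 2 * (indicat_real {R..t} \<sigma> * (\<sigma> * w \<sigma>))" for \<sigma>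
    proof -
      consider "\<sigma> < R" | "R \<le> \<sigma>" "\<sigma> \<le> t" | "t < \<sigma>" by linarith
      then show ?thesis
        by cases (use that in \<open>simp_all add: algebra_simps\<close>)
    qed
    have i2: "integrable lborel (\<lambda>\<sigma>. indicat_real A \<sigma> * w \<sigma>)"
        "integrable lborel (\<lambda>\<sigma>. indicat_real A \<sigma> * (\<sigma> * w \<sigma>))" if "A \<in> sets borel" for A
      using i1[OF that] by (auto simp: set_integrable_def)
    show ?thesis
      unfolding G pt e1 set_lebesgue_integral_def
      by (simp add: i2 iw isw, simp add: algebra_simps)
  qed
  have dW: "((\<lambda>t. integral {R..t} f) has_real_derivative f t) (at t)"
    if "R < t" "continuous_on UNIV f" for R t and f :: "real \<Rightarrow> real"
  proof -
    have "((\<lambda>t. integral {R..t} f) has_real_derivative f t) (at t within {R..t+1})"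
      using that by (intro integral_has_real_derivative) (auto intro: continuous_on_subset)
    moreover have "at t within {R..t+1} = at t"
      using that by (intro at_within_interior) auto
    ultimately show ?thesis by simp
  qed
  have dG: "(G has_real_derivative D R t) (at t)" if "R < t" for R t
  proof (rule has_field_derivative_transform_within_open[where S = "{R<..}"])
    show "((\<lambda>t. \<kappa> * ((2 * (LINT \<sigma>:{..<R}|lborel. w \<sigma>) - (LINT \<sigma>|lborel. w \<sigma>)) * t
      + ((LINT \<sigma>|lborel. \<sigma> * w \<sigma>) - 2 * (LINT \<sigma>:{..<R}|lborel. \<sigma> * w \<sigma>))
      + 2 * (t * integral {R..t} w - integral {R..t} (\<lambda>\<sigma>. \<sigma> * w \<sigma>)))) has_real_derivative D R t) (at t)"
      unfolding D_def using that
      by (auto intro!: derivative_eq_intros dW continuous_intros w simp: algebra_simps)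
  next
    fix x assume "x \<in> {R<..}"
    then show "\<kappa> * ((2 * (LINT \<sigma>:{..<R}|lborel. w \<sigma>) - (LINT \<sigma>|lborel. w \<sigma>)) * x
      + ((LINT \<sigma>|lborel. \<sigma> * w \<sigma>) - 2 * (LINT \<sigma>:{..<R}|lborel. \<sigma> * w \<sigma>))
      + 2 * (x * integral {R..x} w - integral {R..x} (\<lambda>\<sigma>. \<sigma> * w \<sigma>))) = G x"
      by (intro rep[symmetric]) simp
  qed (use that in auto)
  \<comment> \<open>The left side does not depend on \<open>R\<close>, so one base point such as
    \<open>s - 1\<close> describes \<open>deriv G\<close> on a whole neighbourhood of
    \<open>s\<close>.\<close>
  then have dD: "deriv G t = D R t" if "R < t" for R t
    using DERIV_imp_deriv that by blast
  show "(G has_real_derivative deriv G s) (at s)"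
    using dG[of "s - 1" s] dD[of "s - 1" s] by simp
  show "(deriv G has_real_derivative 2 * \<kappa> * w s) (at s)"
  proof (rule has_field_derivative_transform_within_open[where S = "{s - 1<..}"])
    show "(D (s - 1) has_real_derivative 2 * \<kappa> * w s) (at s)"
      unfolding D_def by (auto intro!: derivative_eq_intros dW w)
  qed (use dD in auto)
qed

section \<open>Slope coordinates\<close>

lemma borel_measurable_vector2 [measurable]:
  assumes [measurable]: "f \<in> borel_measurable M" "g \<in> borel_measurable M"
  shows "(\<lambda>x. vector [f x, g x] :: real^2) \<in> borel_measurable M"
proof -
  have "(\<lambda>x. vector [f x, g x] :: real^2) = (\<lambda>x. f x *\<^sub>R axis 1 1 + g x *\<^sub>R axis 2 1)"
    by (auto simp: vec_eq_iff forall_2 axis_def fun_eq_iff)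
  then show ?thesis by simp
qed

text \<open>Carries Tonelli over to \<open>real^2\<close>: Lebesgue measure is determined by its
  values on boxes, and boxes pull back to rectangles.\<close>

lemma lborel_real2_eq_distr:
  "(lborel :: (real^2) measure) = distr (lborel \<Otimes>\<^sub>M lborel) borel (\<lambda>(a, b). vector [a, b])"
proof (rule lborel_eqI)
  have m: "(\<lambda>(a::real, b::real). vector [a, b] :: real^2) \<in> borel_measurable (lborel \<Otimes>\<^sub>M lborel)"
    unfolding split_beta by measurable
  fix l u :: "real^2"
  assume lu: "\<And>b. b \<in> Basis \<Longrightarrow> l \<bullet> b \<le> u \<bullet> b"
  have le: "l $ i \<le> u $ i" for i
    using lu[of "axis i 1"] by (auto simp: Basis_vec_def inner_axis)
  have "(\<lambda>(a, b). vector [a, b]) -` box l u = {l$1<..<u$1} \<times> {l$2<..<u$2}"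
    by (auto simp: mem_box_cart forall_2)
  then have "emeasure (distr (lborel \<Otimes>\<^sub>M lborel) borel (\<lambda>(a::real, b::real). vector [a, b] :: real^2)) (box l u)
    = emeasure (lborel \<Otimes>\<^sub>M lborel) ({l$1<..<u$1} \<times> {l$2<..<u$2})"
    using m by (subst emeasure_distr) (simp_all add: space_pair_measure)
  also have "\<dots> = ennreal ((u$1 - l$1) * (u$2 - l$2))"
    using le by (simp add: lborel.emeasure_pair_measure_Times ennreal_mult)
  also have "(u$1 - l$1) * (u$2 - l$2) = (\<Prod>b\<in>Basis. (u - l) \<bullet> b)"
    by (simp add: Basis_vec_def inner_axis UNIV_2 axis_eq_axis)
  finally show "emeasure (distr (lborel \<Otimes>\<^sub>M lborel) borel (\<lambda>(a::real, b::real). vector [a, b] :: real^2)) (box l u)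
    = ennreal (\<Prod>b\<in>Basis. (u - l) \<bullet> b)" .
qed simp

lemma nn_integral_lborel_real2:
  fixes f :: "real^2 \<Rightarrow> ennreal"
  assumes [measurable]: "f \<in> borel_measurable borel"
  shows "(\<integral>\<^sup>+x. f x \<partial>lborel) = (\<integral>\<^sup>+a. \<integral>\<^sup>+b. f (vector [a, b]) \<partial>lborel \<partial>lborel)"
  by (subst lborel_real2_eq_distr, subst nn_integral_distr)
     (simp_all add: split_beta lborel.nn_integral_fst[symmetric])

lemma nn_integral_power2_symmetric_interval:
  fixes r :: real
  assumes "r \<ge> 0"
  shows "(\<integral>\<^sup>+a. ennreal (a\<^sup>2 * indicator {-r..r} a) \<partial>lborel) = ennreal (2 / 3 * r ^ 3)"
proof -
  have "(\<integral>\<^sup>+a. ennreal (a\<^sup>2) * indicator {-r..r} a \<partial>lborel) = ennreal (r ^ 3 / 3 - (-r) ^ 3 / 3)"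
    using assms by (intro nn_integral_FTC_Icc) (auto intro!: derivative_eq_intros)
  moreover have "(\<integral>\<^sup>+a. ennreal (a\<^sup>2 * indicator {-r..r} a) \<partial>lborel)
    = (\<integral>\<^sup>+a. ennreal (a\<^sup>2) * indicator {-r..r} a \<partial>lborel)"
    by (intro nn_integral_cong) (simp add: indicator_def)
  moreover have "r ^ 3 / 3 - (-r) ^ 3 / 3 = 2 / 3 * r ^ 3"
    by simp
  ultimately show ?thesis by simp
qed

text \<open>On the vertical line at \<open>a\<close>, the substitution
  \<open>b = a * \<sigma>\<close> yields one factor \<bar>a\<bar> from the Jacobian and one from the
  integrand. After exchanging the integrals, \<open>a\<close> runs over \<bar>a\<bar> \<le> 1 / G
  \<sigma>, and integrating a^2 there produces the inverse cube. With nonnegative integrals,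
  integrability of the right side can be read off afterwards.\<close>

lemma nn_integral_starlike_slope:
  fixes K :: "(real^2) set" and G :: "real \<Rightarrow> real"
  assumes K [measurable]: "K \<in> sets borel"
    and G [measurable]: "G \<in> borel_measurable borel"
    and pos: "\<And>\<sigma>. G \<sigma> > 0"
    and mem: "\<And>a \<sigma>. a \<noteq> 0 \<Longrightarrow> vector [a, a * \<sigma>] \<in> K \<longleftrightarrow> \<bar>a\<bar> * G \<sigma> \<le> 1"
  shows "(\<integral>\<^sup>+x. ennreal (indicator K x * \<bar>x$2 - s * x$1\<bar>) \<partial>lborel)
    = (\<integral>\<^sup>+\<sigma>. ennreal (2 / 3 * (\<bar>s - \<sigma>\<bar> * (1 / G \<sigma> ^ 3))) \<partial>lborel)"
proof -
  have [measurable]: "(\<lambda>x::real^2. x $ i) \<in> borel_measurable borel" for i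
    by (intro borel_measurable_continuous_onI continuous_intros)
  have "(\<integral>\<^sup>+x. ennreal (indicator K x * \<bar>x$2 - s * x$1\<bar>) \<partial>lborel)
    = (\<integral>\<^sup>+a. \<integral>\<^sup>+b. ennreal (indicator K (vector [a, b] :: real^2) * \<bar>b - s * a\<bar>) \<partial>lborel \<partial>lborel)"
    by (subst nn_integral_lborel_real2) simp_all
  also have "\<dots> = (\<integral>\<^sup>+a. \<integral>\<^sup>+\<sigma>. ennreal (\<bar>s - \<sigma>\<bar> * (a\<^sup>2 * indicator {-1/G \<sigma>..1/G \<sigma>} a)) \<partial>lborel \<partial>lborel)"
  \<comment> \<open>The substitution degenerates on the line \<open>a = 0\<close>, which is
    null.\<close>
  proof (rule nn_integral_cong_AE, rule AE_mp[OF AE_lborel_singleton[of 0]], intro AE_I2 impI)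
    fix a :: real assume a: "a \<noteq> 0"
    have "(\<integral>\<^sup>+b. ennreal (indicator K (vector [a, b] :: real^2) * \<bar>b - s * a\<bar>) \<partial>lborel)
      = ennreal \<bar>a\<bar> * (\<integral>\<^sup>+\<sigma>. ennreal (indicator K (vector [a, 0 + a * \<sigma>] :: real^2) * \<bar>0 + a * \<sigma> - s * a\<bar>) \<partial>lborel)"
      using a by (intro nn_integral_real_affine) simp_all
    also have "\<dots> = (\<integral>\<^sup>+\<sigma>. ennreal \<bar>a\<bar> * ennreal (indicator K (vector [a, 0 + a * \<sigma>] :: real^2) * \<bar>0 + a * \<sigma> - s * a\<bar>) \<partial>lborel)"
      by (rule nn_integral_cmult[symmetric]) simp
    also have "\<dots> = (\<integral>\<^sup>+\<sigma>. ennreal (\<bar>s - \<sigma>\<bar> * (a\<^sup>2 * indicator {-1/G \<sigma>..1/G \<sigma>} a)) \<partial>lborel)"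
    proof (intro nn_integral_cong)
      fix \<sigma>
      have iff: "vector [a, a * \<sigma>] \<in> K \<longleftrightarrow> a \<in> {-1/G \<sigma>..1/G \<sigma>}"
      proof -
        have "\<bar>a\<bar> * G \<sigma> \<le> 1 \<longleftrightarrow> \<bar>a\<bar> \<le> 1 / G \<sigma>"
          using pos[of \<sigma>] by (simp add: field_simps)
        then show ?thesis by (auto simp: mem[OF a] abs_le_iff)
      qed
      have "\<bar>a * \<sigma> - s * a\<bar> = \<bar>a\<bar> * \<bar>s - \<sigma>\<bar>"
        by (metis abs_minus_commute abs_mult mult.commute right_diff_distrib)
      then have "\<bar>a\<bar> * \<bar>a * \<sigma> - s * a\<bar> = \<bar>s - \<sigma>\<bar> * a\<^sup>2"
        by (simp add: power2_eq_square)
      then show "ennreal \<bar>a\<bar> * ennreal (indicator K (vector [a, 0 + a * \<sigma>] :: real^2) * \<bar>0 + a * \<sigma> - s * a\<bar>)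
        = ennreal (\<bar>s - \<sigma>\<bar> * (a\<^sup>2 * indicator {-1/G \<sigma>..1/G \<sigma>} a))"
        by (subst ennreal_mult''[symmetric]) (auto simp: iff indicator_def)
    qed
    finally show "(\<integral>\<^sup>+b. ennreal (indicator K (vector [a, b] :: real^2) * \<bar>b - s * a\<bar>) \<partial>lborel)
      = (\<integral>\<^sup>+\<sigma>. ennreal (\<bar>s - \<sigma>\<bar> * (a\<^sup>2 * indicator {-1/G \<sigma>..1/G \<sigma>} a)) \<partial>lborel)" .
  qed
  also have "\<dots> = (\<integral>\<^sup>+\<sigma>. \<integral>\<^sup>+a. ennreal (\<bar>s - \<sigma>\<bar> * (a\<^sup>2 * indicator {-1/G \<sigma>..1/G \<sigma>} a)) \<partial>lborel \<partial>lborel)"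
  proof (rule lborel_pair.Fubini')
    have "Measurable.pred (borel \<Otimes>\<^sub>M borel) (\<lambda>x. snd x \<in> {-1 / G (fst x)..1 / G (fst x)})"
      unfolding atLeastAtMost_iff by measurable
    then have [measurable]: "(\<lambda>x. indicat_real {-1 / G (fst x)..1 / G (fst x)} (snd x)) \<in> borel_measurable (borel \<Otimes>\<^sub>M borel)"
      by (intro borel_measurable_indicator') (auto simp: pred_def)
    show "(\<lambda>(\<sigma>, a). ennreal (\<bar>s - \<sigma>\<bar> * (a\<^sup>2 * indicat_real {-1 / G \<sigma>..1 / G \<sigma>} a)))
      \<in> borel_measurable (lborel \<Otimes>\<^sub>M lborel)"
      unfolding split_beta by measurable
  qed
  also have "\<dots> = (\<integral>\<^sup>+\<sigma>. ennreal (2 / 3 * (\<bar>s - \<sigma>\<bar> * (1 / G \<sigma> ^ 3))) \<partial>lborel)"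
  proof (intro nn_integral_cong)
    fix \<sigma>
    have "(\<integral>\<^sup>+a. ennreal (\<bar>s - \<sigma>\<bar> * (a\<^sup>2 * indicator {-1/G \<sigma>..1/G \<sigma>} a)) \<partial>lborel)
      = ennreal \<bar>s - \<sigma>\<bar> * (\<integral>\<^sup>+a. ennreal (a\<^sup>2 * indicator {-(1/G \<sigma>)..1/G \<sigma>} a) \<partial>lborel)"
      by (subst nn_integral_cmult[symmetric]) (simp_all add: ennreal_mult')
    also have "\<dots> = ennreal (2 / 3 * (\<bar>s - \<sigma>\<bar> * (1 / G \<sigma> ^ 3)))"
      using pos[of \<sigma>]
      by (subst nn_integral_power2_symmetric_interval)
         (simp_all add: ennreal_mult''[symmetric] power_divide field_simps)
    finally show "(\<integral>\<^sup>+a. ennreal (\<bar>s - \<sigma>\<bar> * (a\<^sup>2 * indicator {-1/G \<sigma>..1/G \<sigma>} a)) \<partial>lborel)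
      = ennreal (2 / 3 * (\<bar>s - \<sigma>\<bar> * (1 / G \<sigma> ^ 3)))" .
  qed
  finally show ?thesis .
qed

section \<open>Intersection bodies and polarity\<close>

lemma rot90_nth [simp]: "rot90 x $ 1 = - (x $ 2)" "rot90 x $ 2 = x $ 1"
  by (simp_all add: rot90_def)

lemma linear_rot90: "linear rot90"
  by (rule linearI) (simp_all add: vec_eq_iff forall_2)

lemma rot90_rot90 [simp]: "rot90 (rot90 x) = - x"
  by (simp add: vec_eq_iff forall_2)

lemma norm_rot90 [simp]: "norm (rot90 x) = norm x"
  by (simp add: norm_vec_def L2_set_def sum_2 add.commute)

lemma origin_symmetric_uminus_mem_iff: "origin_symmetric K \<Longrightarrow> - x \<in> K \<longleftrightarrow> x \<in> K"
  unfolding origin_symmetric_def by (metis minus_minus)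

text \<open>By symmetry the chord of \<open>K\<close> in direction \<open>rot90 \<xi>\<close> is an
  interval \<open>{-b..b}\<close> of length \<open>2 * b\<close>, so \<open>r\<close> is at most the
  radial function exactly when \<open>r / 2\<close> lies in that interval.\<close>

lemma intersection_body_eq_rot90:
  assumes "compact K" "convex K" "origin_symmetric K" "K \<noteq> {}"
  shows "intersection_body K = {x. (1/2) *\<^sub>R rot90 x \<in> K}"
proof -
  interpret rot90: linear rot90 by (rule linear_rot90)
  have sym: "- x \<in> K \<longleftrightarrow> x \<in> K" for x
    using assms(3) by (rule origin_symmetric_uminus_mem_iff)
  obtain z where "z \<in> K" using assms(4) by blast
  then have "(1/2) *\<^sub>R z + (1/2) *\<^sub>R (- z) \<in> K"
    using assms(2) sym by (intro convexD) auto
  then have 0: "0 \<in> K" by simp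
  have key: "r \<le> ib_radial K \<xi> \<longleftrightarrow> (1/2) *\<^sub>R rot90 (r *\<^sub>R \<xi>) \<in> K" if "norm \<xi> = 1" "r \<ge> 0" for r \<xi>
  proof -
    define S where "S = {s::real. s *\<^sub>R rot90 \<xi> \<in> K}"
    have S: "S = (\<lambda>s. s *\<^sub>R rot90 \<xi>) -` K" by (auto simp: S_def)
    have "convex S"
      unfolding S using assms(2) by (intro convex_linear_vimage linearI) (auto simp: algebra_simps)
    moreover have "closed S"
      unfolding S using assms(1)
      by (intro continuous_closed_vimage compact_imp_closed) (auto intro!: continuous_intros)
    moreover have "bounded S"
    proof -
      obtain B where "\<And>x. x \<in> K \<Longrightarrow> norm x \<le> B"
        using compact_imp_bounded[OF assms(1)] by (auto simp: bounded_iff)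
      then have "norm s \<le> B" if "s \<in> S" for s
        using that \<open>norm \<xi> = 1\<close> by (force simp: S_def)
      then show ?thesis by (auto simp: bounded_iff)
    qed
    ultimately obtain a b where ab: "S = {a..b}"
      using connected_compact_interval_1[of S] convex_connected compact_eq_bounded_closed by blast
    have "0 \<in> S" using 0 by (simp add: S_def)
    moreover have "- s \<in> S \<longleftrightarrow> s \<in> S" for s
      using sym[of "s *\<^sub>R rot90 \<xi>"] by (simp add: S_def)
    ultimately have "a = - b" "b \<ge> 0"
      unfolding ab by (auto simp: antisym) (metis add.inverse_inverse atLeastAtMost_iff le_minus_iff order_antisym order_refl order_trans)
    then have "ib_radial K \<xi> = 2 * b"
      unfolding ib_radial_def S_def[symmetric] ab by simp
    moreover have "(1/2) *\<^sub>R rot90 (r *\<^sub>R \<xi>) \<in> K \<longleftrightarrow> r / 2 \<in> S"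
      by (simp add: S_def rot90.scale)
    ultimately show ?thesis
      using \<open>a = - b\<close> that \<open>b \<ge> 0\<close> by (auto simp: ab)
  qed
  show ?thesis
  proof (intro set_eqI iffI)
    fix x assume "x \<in> intersection_body K"
    then show "x \<in> {x. (1/2) *\<^sub>R rot90 x \<in> K}"
      using key by (auto simp: intersection_body_def)
  next
    fix x assume x: "x \<in> {x. (1/2) *\<^sub>R rot90 x \<in> K}"
    obtain \<xi> :: "real^2" where \<xi>: "norm \<xi> = 1" "x = norm x *\<^sub>R \<xi>"
    proof (cases "x = 0")
      case True
      then show ?thesis using that[of "axis 1 1"] by simp
    next
      case False
      then show ?thesis using that[of "sgn x"] by (simp add: norm_sgn sgn_div_norm)
    qed
    have "norm x \<le> ib_radial K \<xi>"
      using key[of \<xi> "norm x"] x \<xi> by simp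
    then show "x \<in> intersection_body K"
      unfolding intersection_body_def using \<xi> norm_ge_zero by blast
  qed
qed

lemma closed_polar_body: "closed (polar_body L)"
proof -
  have "polar_body L = (\<Inter>x\<in>L. {y. x \<bullet> y \<le> 1})"
    by (auto simp: polar_body_def)
  then show ?thesis by (auto intro!: closed_INT closed_halfspace_le)
qed

lemma bounded_polar_body:
  assumes "0 \<in> interior L"
  shows "bounded (polar_body L)"
proof -
  obtain e where e: "e > 0" "cball 0 e \<subseteq> L"
    using assms by (meson mem_interior_cball)
  have "norm y \<le> 1 / e" if "y \<in> polar_body L" for y
  proof (cases "y = 0")
    case False
    have "(e / norm y) *\<^sub>R y \<in> L"
      using e False by (intro subsetD[OF e(2)]) simp
    then have "((e / norm y) *\<^sub>R y) \<bullet> y \<le> 1"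
      using that by (auto simp: polar_body_def)
    then show ?thesis
      using e False by (simp add: dot_square_norm power2_eq_square field_simps)
  qed (use e in simp)
  then show ?thesis by (auto simp: bounded_iff)
qed

text \<open>The bipolar theorem, with the polar body replaced by its frontier because the homothety
  only describes that curve. The polar is compact, and a nonzero linear functional attains its
  maximum over it on the frontier.\<close>

lemma mem_iff_frontier_polar_body:
  assumes "closed L" "convex L" "0 \<in> interior L"
  shows "x \<in> L \<longleftrightarrow> (\<forall>z\<in>frontier (polar_body L). x \<bullet> z \<le> 1)"
proof
  assume "x \<in> L"
  moreover have "frontier (polar_body L) \<subseteq> polar_body L"
    by (simp add: closed_polar_body frontier_subset_closed)
  ultimately show "\<forall>z\<in>frontier (polar_body L). x \<bullet> z \<le> 1"
    by (auto simp: polar_body_def)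
next
  assume *: "\<forall>z\<in>frontier (polar_body L). x \<bullet> z \<le> 1"
  show "x \<in> L"
  proof (rule ccontr)
    assume "x \<notin> L"
    then obtain a b where ab: "a \<bullet> x < b" "\<forall>y\<in>L. a \<bullet> y > b"
      using separating_hyperplane_closed_point[OF assms(2,1)] by blast
    have "0 \<in> L" using assms(3) interior_subset by blast
    then have b: "b < 0" using ab(2) by force
    \<comment> \<open>As \<open>b\<close> is negative, dividing by it turns the separating
      functional into one that is at most 1 on \<open>L\<close> and exceeds 1 at
      \<open>x\<close>.\<close>
    have "(1 / b) *\<^sub>R a \<in> polar_body L"
      using ab(2) b by (auto simp: polar_body_def field_simps inner_commute intro: less_imp_le)
    moreover have "x \<bullet> ((1 / b) *\<^sub>R a) > 1"
      using ab(1) b by (simp add: field_simps inner_commute)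
    moreover have "compact (polar_body L)"
      by (simp add: compact_eq_bounded_closed closed_polar_body bounded_polar_body assms)
    moreover from this obtain z where z: "z \<in> polar_body L" "\<And>y. y \<in> polar_body L \<Longrightarrow> x \<bullet> y \<le> x \<bullet> z"
      using continuous_attains_sup[of "polar_body L" "\<lambda>y. x \<bullet> y"] calculation(1)
        continuous_on_inner[OF continuous_on_const continuous_on_id] by blast
    ultimately have "x \<bullet> z > 1" by force
    \<comment> \<open>a linear functional has no maximum at an interior point\<close>
    have "z \<notin> interior (polar_body L)"
    proof
      assume "z \<in> interior (polar_body L)"
      then obtain e where e: "e > 0" "cball z e \<subseteq> polar_body L"
        by (meson mem_interior_cball)
      have x0: "x \<noteq> 0" using \<open>x \<bullet> z > 1\<close> by auto
      have "z + (e / norm x) *\<^sub>R x \<in> polar_body L"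
        using e x0 by (intro subsetD[OF e(2)]) (simp add: dist_norm)
      then have "x \<bullet> (z + (e / norm x) *\<^sub>R x) \<le> x \<bullet> z" by (rule z(2))
      then have "(e / norm x) * (x \<bullet> x) \<le> 0" by (simp add: inner_add_right)
      moreover have "(e / norm x) * (x \<bullet> x) > 0" using e x0 by simp
      ultimately show False by simp
    qed
    then have "z \<in> frontier (polar_body L)"
      using z(1) by (simp add: frontier_def closed_polar_body closure_closed)
    then show False using * \<open>x \<bullet> z > 1\<close> by force
  qed
qed

section \<open>Absolute first moments and half centroids\<close>

lemma lborel_distr_uminus_euclidean:
  "distr lborel borel uminus = (lborel :: 'a::euclidean_space measure)"
proof -
  have eq: "(\<lambda>x::'a. 0 + (-1) *\<^sub>R x) = uminus" by auto
  have "density (distr lborel borel uminus) (\<lambda>_. ennreal (\<bar>-1\<bar> ^ DIM('a))) = (lborel :: 'a measure)"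
    unfolding eq[symmetric] by (rule lborel_affine[symmetric]) simp
  then show ?thesis by (simp add: density_1)
qed

lemma lebesgue_integral_reflect:
  fixes f :: "'a::euclidean_space \<Rightarrow> real"
  shows "(LINT x|lborel. f (- x)) = (LINT x|lborel. f x)"
proof (cases "f \<in> borel_measurable borel")
  case True
  then show ?thesis
    using integral_distr[of uminus lborel borel f] by (simp add: lborel_distr_uminus_euclidean)
next
  \<comment> \<open>For non-measurable \<open>f\<close> both integrals take the default value
    0.\<close>
  case False
  have "(\<lambda>x. f (- x)) \<notin> borel_measurable borel"
  proof
    assume "(\<lambda>x. f (- x)) \<in> borel_measurable borel"
    then have "(\<lambda>x. f (- (- x))) \<in> borel_measurable borel"
      by measurable
    then show False using False by simp
  qed
  then have "\<not> integrable lborel (\<lambda>x. f (- x))" "\<not> integrable lborel f"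
    using False borel_measurable_integrable[of lborel f]
      borel_measurable_integrable[of lborel "\<lambda>x. f (- x)"] by auto
  from this[THEN not_integrable_integral_eq] show ?thesis by simp
qed

text \<open>Divided by the area of \<open>K\<close>, this is the support function of the centroid
  body of \<open>K\<close>.\<close>

definition abs_moment :: "(real^2) set \<Rightarrow> real^2 \<Rightarrow> real" where
  "abs_moment K x = (LINT y|lborel. indicat_real K y * \<bar>y \<bullet> x\<bar>)"

lemma integrable_on_compact:
  fixes f :: "'a::euclidean_space \<Rightarrow> real"
  assumes "compact S" "continuous_on UNIV f"
  shows "integrable lborel (\<lambda>y. indicat_real S y * f y)"
  using borel_integrable_compact[OF assms(1) continuous_on_subset[OF assms(2)]] by simp

text \<open>The two halves are mirror images in the origin and overlap in a piece of a line, which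
  is null.\<close>

lemma measure_half_symmetric:
  fixes K :: "(real^2) set"
  assumes "compact K" "origin_symmetric K" "x \<noteq> 0"
  shows "measure lebesgue (K \<inter> {y. y \<bullet> x \<le> 0}) = measure lebesgue K / 2"
proof -
  have sym: "- x \<in> K \<longleftrightarrow> x \<in> K" for x
    using assms(2) by (rule origin_symmetric_uminus_mem_iff)
  have c: "compact (K \<inter> {y. y \<bullet> x \<le> 0})" "compact (K \<inter> {y. y \<bullet> x \<ge> 0})"
    using assms(1) closed_halfspace_le[of x 0] closed_halfspace_ge[of 0 x]
    by (auto intro!: compact_Int_closed simp: inner_commute)
  have ind: "measure lebesgue S = (LINT y|lborel. indicat_real S y)" if "compact S" for S :: "(real^2) set"
    using that by (simp add: borel_compact)
  have "indicat_real (K \<inter> {y. y \<bullet> x \<le> 0}) (- y) = indicat_real (K \<inter> {y. y \<bullet> x \<ge> 0}) y" for y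
    by (simp add: indicator_def sym)
  then have eq: "measure lebesgue (K \<inter> {y. y \<bullet> x \<ge> 0}) = measure lebesgue (K \<inter> {y. y \<bullet> x \<le> 0})"
    using lebesgue_integral_reflect[of "indicat_real (K \<inter> {y. y \<bullet> x \<le> 0})"]
    by (simp only: ind[OF c(1)] ind[OF c(2)])
  have "negligible {y. x \<bullet> y = 0}"
    using assms(3) by (intro negligible_hyperplane) simp
  then have "negligible ((K \<inter> {y. y \<bullet> x \<le> 0}) \<inter> (K \<inter> {y. y \<bullet> x \<ge> 0}))"
    by (rule negligible_subset) (auto simp: inner_commute)
  then have "measure lebesgue ((K \<inter> {y. y \<bullet> x \<le> 0}) \<inter> (K \<inter> {y. y \<bullet> x \<ge> 0})) = 0"
    by (rule negligible_imp_measure0)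
  then have "measure lebesgue ((K \<inter> {y. y \<bullet> x \<le> 0}) \<union> (K \<inter> {y. y \<bullet> x \<ge> 0}))
    = measure lebesgue (K \<inter> {y. y \<bullet> x \<le> 0}) + measure lebesgue (K \<inter> {y. y \<bullet> x \<ge> 0})"
    using measure_Un3[OF lmeasurable_compact[OF c(1)] lmeasurable_compact[OF c(2)]] by simp
  moreover have "(K \<inter> {y. y \<bullet> x \<le> 0}) \<union> (K \<inter> {y. y \<bullet> x \<ge> 0}) = K" by auto
  ultimately show ?thesis using eq by simp
qed

lemma integral_inner_symmetric_eq_0:
  assumes "origin_symmetric K"
  shows "(LINT y|lborel. indicat_real K y * (y \<bullet> x)) = 0"
proof -
  have "- y \<in> K \<longleftrightarrow> y \<in> K" for y
    using assms by (rule origin_symmetric_uminus_mem_iff)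
  then have "indicat_real K (- y) = indicat_real K y" for y
    by (simp add: indicator_def)
  then show ?thesis
    using lebesgue_integral_reflect[of "\<lambda>y. indicat_real K y * (y \<bullet> x)"] by simp
qed

text \<open>Passes from the vector-valued gauge integral in \<open>centroid\<close> to real Lebesgue
  integrals.\<close>

lemma centroid_inner:
  assumes "compact S"
  shows "centroid S \<bullet> x = (1 / measure lebesgue S) * (LINT y|lborel. indicat_real S y * (y \<bullet> x))"
proof -
  have "set_integrable lborel S (\<lambda>y. y)"
    unfolding set_integrable_def using assms by (intro borel_integrable_compact continuous_intros)
  then have "(\<lambda>y. y) integrable_on S"
    by (rule set_borel_integral_eq_integral)
  then have "integral S (\<lambda>y. y) \<bullet> x = integral S (\<lambda>y. y \<bullet> x)"
    using integral_linear[of "\<lambda>y. y" S "\<lambda>y. y \<bullet> x"] by (simp add: bounded_linear_inner_left o_def)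
  also have "\<dots> = (LINT y:S|lborel. y \<bullet> x)"
    unfolding set_integrable_def using assms
    by (intro set_borel_integral_eq_integral(2)[symmetric])
       (simp add: set_integrable_def integrable_on_compact continuous_intros)
  finally show ?thesis by (simp add: centroid_def set_lebesgue_integral_def)
qed

text \<open>Up to the factor \<open>1 / measure lebesgue K\<close>, the left side integrates
  \<open>y \<bullet> x\<close> over \<open>K\<close> with weight +1 on \<open>S\<close> and -1 off
  \<open>S\<close>. The best choice of signs gives the absolute value, and it is reached when
  \<open>S\<close> collects the points with positive product.\<close>

lemma half_centroid_inner_le:
  assumes K: "compact K" "origin_symmetric K" and S: "compact S" "S \<subseteq> K"
    and half: "measure lebesgue S = measure lebesgue K / 2"
  shows "centroid S \<bullet> x \<le> abs_moment K x / measure lebesgue K"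
    and "(\<And>y. y \<in> S \<Longrightarrow> y \<bullet> x \<ge> 0) \<Longrightarrow> (\<And>y. y \<in> K - S \<Longrightarrow> y \<bullet> x \<le> 0) \<Longrightarrow>
      centroid S \<bullet> x = abs_moment K x / measure lebesgue K"
proof -
  \<comment> \<open>subtracting the vanishing first moment of \<open>K\<close> turns \<open>2 \<integral>\<^sub>S\<close> into \<open>\<integral>\<^sub>S - \<integral>\<^bsub>K - S\<^esub>\<close>\<close>
  define I where "I = (LINT y|lborel. 2 * (indicat_real S y * (y \<bullet> x)) - indicat_real K y * (y \<bullet> x))"
  have int: "integrable lborel (\<lambda>y. indicat_real S y * (y \<bullet> x))"
    "integrable lborel (\<lambda>y. indicat_real K y * (y \<bullet> x))"
    "integrable lborel (\<lambda>y. indicat_real K y * \<bar>y \<bullet> x\<bar>)"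
    by (intro integrable_on_compact K S continuous_intros)+
  have "I = 2 * (LINT y|lborel. indicat_real S y * (y \<bullet> x)) - (LINT y|lborel. indicat_real K y * (y \<bullet> x))"
    unfolding I_def using int by (subst Bochner_Integration.integral_diff) auto
  then have I: "centroid S \<bullet> x = I / measure lebesgue K"
    by (simp add: centroid_inner S half integral_inner_symmetric_eq_0 K)
  have "I \<le> abs_moment K x"
    unfolding I_def abs_moment_def
    by (intro integral_mono int Bochner_Integration.integrable_diff integrable_mult_right)
       (use S(2) in \<open>auto simp: indicator_def\<close>)
  then show "centroid S \<bullet> x \<le> abs_moment K x / measure lebesgue K"
    unfolding I by (intro divide_right_mono) auto
  assume "\<And>y. y \<in> S \<Longrightarrow> y \<bullet> x \<ge> 0" "\<And>y. y \<in> K - S \<Longrightarrow> y \<bullet> x \<le> 0"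
  then have "I = abs_moment K x"
    unfolding I_def abs_moment_def using S(2)
    by (intro Bochner_Integration.integral_cong) (auto simp: indicator_def)
  then show "centroid S \<bullet> x = abs_moment K x / measure lebesgue K"
    unfolding I by simp
qed

text \<open>The bound for sets of half the area applies to each cut, wherever its line lies.
  Together with \<open>Gamma_inner_attained\<close> it identifies the support function of
  \<open>Gamma\<close>.\<close>

lemma Gamma_inner_le:
  assumes "compact K" "origin_symmetric K" "z \<in> Gamma (measure lebesgue K / 2) K"
  shows "z \<bullet> x \<le> abs_moment K x / measure lebesgue K"
proof -
  obtain \<xi> t where z: "z = centroid (K \<inter> {y. y \<bullet> \<xi> \<le> t})"
    "measure lebesgue (K \<inter> {y. y \<bullet> \<xi> \<le> t}) = measure lebesgue K / 2"
    using assms(3) by (auto simp: Gamma_def)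
  have "compact (K \<inter> {y. y \<bullet> \<xi> \<le> t})"
    using assms(1) closed_halfspace_le[of \<xi> t] by (intro compact_Int_closed) (simp_all add: inner_commute)
  then show ?thesis
    unfolding z(1) using assms z(2) by (intro half_centroid_inner_le(1)) auto
qed

lemma Gamma_inner_attained:
  assumes "compact K" "origin_symmetric K" "x \<noteq> 0"
  obtains z where "z \<in> Gamma (measure lebesgue K / 2) K" "z \<bullet> x = abs_moment K x / measure lebesgue K"
proof -
  \<comment> \<open>\<open>Gamma\<close> keeps the side \<open>y \<bullet> \<xi> \<le> t\<close>, so
    the minus sign selects the half where \<open>y \<bullet> x\<close> is nonnegative.\<close>
  define \<xi> where "\<xi> = - sgn x"
  have \<xi>: "norm \<xi> = 1" using assms(3) by (simp add: \<xi>_def norm_sgn)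
  have nn: "y \<bullet> \<xi> \<le> 0 \<longleftrightarrow> y \<bullet> x \<ge> 0" for y
    using assms(3) by (simp add: \<xi>_def sgn_div_norm zero_le_mult_iff zero_le_divide_iff)
  let ?S = "K \<inter> {y. y \<bullet> \<xi> \<le> 0}"
  have half: "measure lebesgue ?S = measure lebesgue K / 2"
    using assms \<xi> by (intro measure_half_symmetric) auto
  have "compact ?S"
    using assms(1) closed_halfspace_le[of \<xi> 0] by (intro compact_Int_closed) (simp_all add: inner_commute)
  then have "centroid ?S \<bullet> x = abs_moment K x / measure lebesgue K"
    using assms half by (intro half_centroid_inner_le(2)) (auto simp: nn)
  moreover have "centroid ?S \<in> Gamma (measure lebesgue K / 2) K"
    unfolding Gamma_def using \<xi> half by blast
  ultimately show ?thesis using that by blast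
qed

section \<open>Homogeneity and continuity of the absolute moment, and the gauge of
  \<open>K\<close>\<close>

lemma abs_moment_minus [simp]: "abs_moment K (- x) = abs_moment K x"
  by (simp add: abs_moment_def)

lemma abs_moment_scaleR: "abs_moment K (c *\<^sub>R x) = \<bar>c\<bar> * abs_moment K x"
  by (simp add: abs_moment_def abs_mult mult.left_commute)

lemma abs_moment_nonneg: "abs_moment K x \<ge> 0"
  unfolding abs_moment_def by (intro integral_nonneg_AE) auto

lemma abs_moment_lipschitz:
  assumes "compact K"
  shows "\<bar>abs_moment K x - abs_moment K x'\<bar> \<le> (LINT y|lborel. indicat_real K y * norm y) * norm (x - x')"
proof -
  have int: "integrable lborel (\<lambda>y. indicat_real K y * \<bar>y \<bullet> x\<bar>)" for x
    by (intro integrable_on_compact assms continuous_intros)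
  have int2: "integrable lborel (\<lambda>y. indicat_real K y * norm y * norm (x - x'))"
    by (intro integrable_mult_left integrable_on_compact assms continuous_intros)
  have "\<bar>abs_moment K x - abs_moment K x'\<bar>
    = \<bar>LINT y|lborel. indicat_real K y * \<bar>y \<bullet> x\<bar> - indicat_real K y * \<bar>y \<bullet> x'\<bar>\<bar>"
    by (simp add: abs_moment_def Bochner_Integration.integral_diff int)
  also have "\<dots> \<le> (LINT y|lborel. \<bar>indicat_real K y * \<bar>y \<bullet> x\<bar> - indicat_real K y * \<bar>y \<bullet> x'\<bar>\<bar>)"
    by (rule integral_abs_bound)
  also have "\<dots> \<le> (LINT y|lborel. indicat_real K y * norm y * norm (x - x'))"
  proof (intro integral_mono int2 integrable_abs Bochner_Integration.integrable_diff int)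
    fix y
    have "\<bar>\<bar>y \<bullet> x\<bar> - \<bar>y \<bullet> x'\<bar>\<bar> \<le> \<bar>y \<bullet> (x - x')\<bar>"
      by (simp add: inner_diff_right)
    also have "\<dots> \<le> norm y * norm (x - x')"
      by (rule Cauchy_Schwarz_ineq2)
    finally show "\<bar>indicat_real K y * \<bar>y \<bullet> x\<bar> - indicat_real K y * \<bar>y \<bullet> x'\<bar>\<bar>
      \<le> indicat_real K y * norm y * norm (x - x')"
      by (simp add: indicator_def)
  qed
  finally show ?thesis by simp
qed

text \<open>Needed twice: for the continuity of the weight in the integral equation, and to extend
  the quadratic identity to the vertical axis.\<close>

lemma continuous_on_abs_moment:
  assumes "compact K"
  shows "continuous_on A (abs_moment K)"
proof -
  define B where "B = (LINT y|lborel. indicat_real K y * norm y)"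
  have "B \<ge> 0" unfolding B_def by (intro integral_nonneg_AE) auto
  then have "B-lipschitz_on A (abs_moment K)"
    using abs_moment_lipschitz[OF assms] by (intro lipschitz_onI) (auto simp: B_def dist_norm)
  then show ?thesis by (rule lipschitz_on_continuous_on)
qed

text \<open>Testing \<open>x\<close> against the frontier of the polar amounts to testing it against
  a scaled and translated \<open>Gamma\<close>, which only involves the support function of
  \<open>Gamma\<close>. Symmetry removes the translation, and undoing the quarter turn returns from
  the intersection body to \<open>K\<close>.\<close>

lemma convex_body_sublevel_abs_moment:
  assumes "convex_body K" "origin_symmetric K"
    and "homothetic (Gamma (measure lebesgue K / 2) K) (frontier (polar_body (intersection_body K)))"
  obtains C where "C \<ge> 0" "\<And>x. x \<in> K \<longleftrightarrow> C * abs_moment K (rot90 x) \<le> 1"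
proof -
  interpret rot90: linear rot90 by (rule linear_rot90)
  have K: "compact K" "convex K" "interior K \<noteq> {}" using assms(1) by (auto simp: convex_body_def)
  have sym: "- x \<in> K \<longleftrightarrow> x \<in> K" for x
    using assms(2) by (rule origin_symmetric_uminus_mem_iff)
  obtain z where z: "z \<in> interior K" using K(3) by blast
  \<comment> \<open>The origin is the midpoint of an interior point and its mirror image, hence
    interior.\<close>
  then have "- z \<in> K" using sym interior_subset by blast
  then have "- z - (1/2) *\<^sub>R (- z - z) \<in> interior K"
    using z K(2) by (intro mem_interior_convex_shrink) auto
  then have 0: "0 \<in> interior K" by (simp add: scaleR_right_diff_distrib flip: scaleR_add_left)
  define L where "L = {x. (1/2) *\<^sub>R rot90 x \<in> K}"
  define h where "h x = abs_moment K x / measure lebesgue K" for x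
  have L: "intersection_body K = L"
    unfolding L_def using K assms(2) interior_subset by (intro intersection_body_eq_rot90) auto
  have Lv: "L = (\<lambda>x. (1/2) *\<^sub>R rot90 x) -` K" by (auto simp: L_def)
  have lin: "linear (\<lambda>x. (1/2) *\<^sub>R rot90 x)"
    by (intro linear_compose_scale_right linear_rot90)
  have cont: "continuous_on UNIV (\<lambda>x. (1/2) *\<^sub>R rot90 x)"
    using lin by (simp add: linear_continuous_on linear_conv_bounded_linear)
  have "closed L"
    unfolding Lv using K(1) cont by (intro continuous_closed_vimage compact_imp_closed) (auto simp: continuous_on_eq_continuous_at)
  moreover have "convex L"
    unfolding Lv using lin K(2) by (rule convex_linear_vimage)
  moreover have "0 \<in> interior L"
  proof (rule interiorI)
    show "open ((\<lambda>x. (1/2) *\<^sub>R rot90 x) -` interior K)"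
      using cont by (intro open_vimage) auto
    show "(\<lambda>x. (1/2) *\<^sub>R rot90 x) -` interior K \<subseteq> L"
      unfolding Lv using interior_subset by blast
  qed (use 0 in \<open>simp add: rot90.zero\<close>)
  ultimately have mem: "x \<in> L \<longleftrightarrow> (\<forall>z\<in>frontier (polar_body L). x \<bullet> z \<le> 1)" for x
    by (rule mem_iff_frontier_polar_body)
  obtain q c where c: "c > 0"
    and fr: "frontier (polar_body L) = (\<lambda>x. q + c *\<^sub>R (x - q)) ` Gamma (measure lebesgue K / 2) K"
    using assms(3) unfolding homothetic_def L by blast
  \<comment> \<open>The homothety sends \<open>x\<close> to
    \<open>v + c *\<^sub>R x\<close>.\<close>
  define v where "v = q - c *\<^sub>R q"
  have mem2: "x \<in> L \<longleftrightarrow> v \<bullet> x + c * h x \<le> 1" for x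
  proof (cases "x = 0")
    case True
    then show ?thesis
      using \<open>0 \<in> interior L\<close> interior_subset by (auto simp: h_def abs_moment_def)
  next
    case False
    obtain z0 where z0: "z0 \<in> Gamma (measure lebesgue K / 2) K" "z0 \<bullet> x = h x"
      using Gamma_inner_attained[OF K(1) assms(2) False] unfolding h_def by blast
    have le: "z \<bullet> x \<le> h x" if "z \<in> Gamma (measure lebesgue K / 2) K" for z
      unfolding h_def by (rule Gamma_inner_le[OF K(1) assms(2) that])
    have "x \<in> L \<longleftrightarrow> (\<forall>z\<in>Gamma (measure lebesgue K / 2) K. v \<bullet> x + c * (z \<bullet> x) \<le> 1)"
      unfolding mem fr by (simp add: v_def inner_commute[of x] algebra_simps)
    also have "\<dots> \<longleftrightarrow> v \<bullet> x + c * h x \<le> 1"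
    proof
      assume "v \<bullet> x + c * h x \<le> 1"
      moreover have "c * (z \<bullet> x) \<le> c * h x" if "z \<in> Gamma (measure lebesgue K / 2) K" for z
        using c le[OF that] by simp
      ultimately show "\<forall>z\<in>Gamma (measure lebesgue K / 2) K. v \<bullet> x + c * (z \<bullet> x) \<le> 1"
        by force
    qed (use z0 in force)
    finally show ?thesis .
  qed
  \<comment> \<open>the gauge of \<open>L\<close> and \<open>h\<close> are even, hence so is the linear part\<close>
  have "v \<bullet> v = 0"
  proof (rule ccontr)
    assume nz: "v \<bullet> v \<noteq> 0"
    define m where "m = c * h v - v \<bullet> v"
    have h: "h v \<ge> 0" by (simp add: h_def abs_moment_nonneg)
    have pos: "v \<bullet> v > 0" using nz by (simp add: order_less_le)
    \<comment> \<open>The scale \<open>t\<close> is chosen so that \<open>- (t *\<^sub>R v)\<close>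
      satisfies the inequality of \<open>mem2\<close> while \<open>t *\<^sub>R v\<close> violates
      it, against the symmetry of \<open>L\<close>; \<open>m\<close> is the value of its left side
      at \<open>- v\<close>.\<close>
    obtain t where t: "t > 0" "t * m \<le> 1" "t * (v \<bullet> v + c * h v) > 1"
    proof (cases "m \<le> 0")
      case True
      have "2 / (v \<bullet> v) * (v \<bullet> v + c * h v) = 2 + 2 / (v \<bullet> v) * (c * h v)"
        using pos by (simp add: field_simps)
      moreover have "2 / (v \<bullet> v) * (c * h v) \<ge> 0" using pos h c by simp
      ultimately show ?thesis
        using that[of "2 / (v \<bullet> v)"] True pos by (simp add: mult_nonneg_nonpos divide_nonpos_pos)
    next
      case False
      have "m < v \<bullet> v + c * h v" using pos by (simp add: m_def)
      then show ?thesis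
        using that[of "1 / m"] False by (simp add: field_simps)
    qed
    have ht: "h (t *\<^sub>R v) = t * h v" "h (- (t *\<^sub>R v)) = t * h v"
      using t(1) by (simp_all add: h_def abs_moment_scaleR)
    have "- (t *\<^sub>R v) \<in> L"
      unfolding mem2 ht using t(2) by (simp add: m_def algebra_simps)
    then have "t *\<^sub>R v \<in> L"
      using sym by (simp add: L_def rot90.neg)
    then show False
      unfolding mem2 ht using t(3) by (simp add: algebra_simps)
  qed
  then have v: "v = 0" by simp
  have "x \<in> K \<longleftrightarrow> (2 * c / measure lebesgue K) * abs_moment K (rot90 x) \<le> 1" for x
  proof -
    \<comment> \<open>The factor 2 cancels the half in \<open>L\<close>, and two quarter turns give
      \<open>- x\<close>, which symmetry identifies with \<open>x\<close>.\<close>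
    have "x \<in> K \<longleftrightarrow> 2 *\<^sub>R rot90 x \<in> L"
      using sym[of x] by (simp add: L_def rot90.scale)
    also have "\<dots> \<longleftrightarrow> (2 * c / measure lebesgue K) * abs_moment K (rot90 x) \<le> 1"
      unfolding mem2 v by (simp add: h_def abs_moment_scaleR mult_ac)
    finally show ?thesis .
  qed
  then show ?thesis using that[of "2 * c / measure lebesgue K"] c by simp
qed

section \<open>Ellipses\<close>

lemma is_ellipse_quadratic_sublevel:
  fixes a b d :: real
  assumes pos: "\<And>x::real^2. x \<noteq> 0 \<Longrightarrow> a * (x$1)\<^sup>2 + b * (x$1 * x$2) + d * (x$2)\<^sup>2 > 0"
  shows "is_ellipse {x. a * (x$1)\<^sup>2 + b * (x$1 * x$2) + d * (x$2)\<^sup>2 \<le> 1}"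
proof -
  have "(vector [1, 0] :: real^2) \<noteq> 0" by (simp add: vec_eq_iff forall_2)
  from pos[OF this] have a: "a > 0" by simp
  \<comment> \<open>This vector minimises the form on the line \<open>x$2 = 1\<close>, with the
    completed-square remainder as its value.\<close>
  have "(vector [- b / (2 * a), 1] :: real^2) \<noteq> 0" by (simp add: vec_eq_iff forall_2)
  from pos[OF this] have D: "d - b\<^sup>2 / (4 * a) > 0"
    using a by (simp add: power2_eq_square field_simps)
  define p r where "p = sqrt a" and "r = sqrt (d - b\<^sup>2 / (4 * a))"
  have p: "p > 0" "a = p\<^sup>2" and r: "r > 0" "r\<^sup>2 = d - b\<^sup>2 / (4 * a)"
    using a D by (simp_all add: p_def r_def)
  have d: "d = r\<^sup>2 + (b / (2 * p))\<^sup>2"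
    using p r(2) by (simp add: power2_eq_square)
  have Q: "a * u\<^sup>2 + b * (u * v) + d * v\<^sup>2 = (p * u + b / (2 * p) * v)\<^sup>2 + (r * v)\<^sup>2" for u v
    unfolding d p(2) using p(1) by (simp add: power2_eq_square field_simps)
  \<comment> \<open>The inverse of the triangular matrix with rows (p, b / (2 p)) and (0, r), which
    by \<open>Q\<close> maps the sublevel set onto the unit disc.\<close>
  define M :: "real^2^2" where
    "M = vector [vector [1 / p, - b / (2 * p) / (p * r)], vector [0, 1 / r]]"
  have Mv: "(M *v y) $ 1 = (y$1 - b / (2 * p) * (y$2 / r)) / p" "(M *v y) $ 2 = y$2 / r" for y
    using p(1) r(1) by (simp_all add: M_def matrix_vector_mult_def sum_2 field_simps)
  have "det M = 1 / p * (1 / r)" by (simp add: M_def det_2)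
  then have "invertible M" using p(1) r(1) by (simp add: invertible_det_nz)
  have nm: "norm y \<le> 1 \<longleftrightarrow> (y$1)\<^sup>2 + (y$2)\<^sup>2 \<le> 1" for y :: "real^2"
    by (simp add: norm_vec_def L2_set_def sum_2)
  have QM: "p * (M *v y) $ 1 + b / (2 * p) * (M *v y) $ 2 = y $ 1" "r * (M *v y) $ 2 = y $ 2" for y
    using p(1) r(1) by (simp_all add: Mv)
  have "{x. a * (x$1)\<^sup>2 + b * (x$1 * x$2) + d * (x$2)\<^sup>2 \<le> 1} = (\<lambda>y. 0 + M *v y) ` cball 0 1"
  proof (intro set_eqI iffI)
    fix x :: "real^2"
    assume x: "x \<in> {x. a * (x$1)\<^sup>2 + b * (x$1 * x$2) + d * (x$2)\<^sup>2 \<le> 1}"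
    define y :: "real^2" where "y = vector [p * x$1 + b / (2 * p) * x$2, r * x$2]"
    have "x = 0 + M *v y"
      using p(1) r(1) by (simp add: vec_eq_iff forall_2 Mv y_def)
    moreover have "y \<in> cball 0 1"
      using x unfolding Q by (simp add: nm y_def)
    ultimately show "x \<in> (\<lambda>y. 0 + M *v y) ` cball 0 1" by blast
  next
    fix x assume "x \<in> (\<lambda>y. 0 + M *v y) ` cball 0 1"
    then obtain y where "x = M *v y" "norm y \<le> 1" by auto
    then show "x \<in> {x. a * (x$1)\<^sup>2 + b * (x$1 * x$2) + d * (x$2)\<^sup>2 \<le> 1}"
      by (simp only: mem_Collect_eq Q QM nm)
  qed
  then show ?thesis unfolding is_ellipse_def using \<open>invertible M\<close> by blast
qed

text \<open>The function \<open>G\<close> plays two roles: by \<open>mem\<close> it is the gauge of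
  \<open>K\<close> at (1, s), and by definition it is a moment of \<open>K\<close>. Computing the
  moment in slope coordinates closes the loop and gives the integral equation.\<close>

lemma abs_moment_slope_quadratic:
  assumes K: "compact K"
    and mem: "\<And>x. x \<in> K \<longleftrightarrow> C * abs_moment K (rot90 x) \<le> 1"
    and pos: "\<And>x. x \<noteq> 0 \<Longrightarrow> C * abs_moment K (rot90 x) > 0"
  obtains a b d where "\<And>s. (C * abs_moment K (rot90 (vector [1, s])))\<^sup>2 = a + b * s + d * s\<^sup>2"
proof -
  interpret rot90: linear rot90 by (rule linear_rot90)
  define G where "G s = C * abs_moment K (rot90 (vector [1, s]))" for s
  have "(vector [1, s] :: real^2) \<noteq> 0" for s by (simp add: vec_eq_iff forall_2)
  then have Gpos: "G s > 0" for s unfolding G_def by (rule pos)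
  have "continuous_on UNIV (\<lambda>s. rot90 (vector [1, s]))"
  proof -
    have "(\<lambda>s. rot90 (vector [1, s])) = (\<lambda>s. axis 2 1 - s *\<^sub>R axis 1 1)"
      by (auto simp: vec_eq_iff forall_2 axis_def fun_eq_iff)
    then show ?thesis by (simp only:) (intro continuous_intros)
  qed
  then have Gc: "continuous_on UNIV G"
    unfolding G_def
    by (intro continuous_intros continuous_on_compose2[OF continuous_on_abs_moment[OF K]]) auto
  have memG: "vector [a, a * \<sigma>] \<in> K \<longleftrightarrow> \<bar>a\<bar> * G \<sigma> \<le> 1" for a \<sigma>
  proof -
    have "vector [a, a * \<sigma>] = a *\<^sub>R (vector [1, \<sigma>] :: real^2)"
      by (simp add: vec_eq_iff forall_2)
    then show ?thesis by (simp add: mem rot90.scale abs_moment_scaleR G_def mult_ac)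
  qed
  \<comment> \<open>The quarter turn of (1, s) is (-s, 1).\<close>
  have ind: "abs_moment K (rot90 (vector [1, s])) = (LINT y|lborel. indicat_real K y * \<bar>y$2 - s * y$1\<bar>)" for s
    by (simp add: abs_moment_def inner_vec_def sum_2 mult.commute)
  \<comment> \<open>The planar integral is finite because \<open>K\<close> is compact, so the slope
    integrand is integrable too and has the same integral.\<close>
  have hb: "has_bochner_integral lborel (\<lambda>\<sigma>. 2 / 3 * (\<bar>s - \<sigma>\<bar> * (1 / G \<sigma> ^ 3)))
      (abs_moment K (rot90 (vector [1, s])))" for s
  proof (rule has_bochner_integral_nn_integral)
    have Gm [measurable]: "G \<in> borel_measurable borel"
      using Gc by (rule borel_measurable_continuous_onI)
    show "(\<lambda>\<sigma>. 2 / 3 * (\<bar>s - \<sigma>\<bar> * (1 / G \<sigma> ^ 3))) \<in> borel_measurable lborel"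
      by measurable
    show "AE \<sigma> in lborel. 0 \<le> 2 / 3 * (\<bar>s - \<sigma>\<bar> * (1 / G \<sigma> ^ 3))"
      using Gpos by (intro AE_I2) (simp add: less_imp_le)
    have "(\<integral>\<^sup>+\<sigma>. ennreal (2 / 3 * (\<bar>s - \<sigma>\<bar> * (1 / G \<sigma> ^ 3))) \<partial>lborel)
      = (\<integral>\<^sup>+y. ennreal (indicator K y * \<bar>y$2 - s * y$1\<bar>) \<partial>lborel)"
      using K Gm Gpos memG by (intro nn_integral_starlike_slope[symmetric]) (auto simp: borel_compact)
    also have "\<dots> = ennreal (LINT y|lborel. indicat_real K y * \<bar>y$2 - s * y$1\<bar>)"
      by (intro nn_integral_eq_integral integrable_on_compact K continuous_intros) auto
    finally show "(\<integral>\<^sup>+\<sigma>. ennreal (2 / 3 * (\<bar>s - \<sigma>\<bar> * (1 / G \<sigma> ^ 3))) \<partial>lborel)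
      = ennreal (abs_moment K (rot90 (vector [1, s])))" by (simp only: ind)
  qed (rule abs_moment_nonneg)
  have int: "integrable lborel (\<lambda>\<sigma>. \<bar>s - \<sigma>\<bar> * (1 / G \<sigma> ^ 3))" for s
    using integrable_mult_right[OF integrable.intros[OF hb[of s]], of "3 / 2"] by simp
  have eq: "G s = 2 * C / 3 * (LINT \<sigma>|lborel. \<bar>s - \<sigma>\<bar> * (1 / G \<sigma> ^ 3))" for s
    unfolding G_def[of s]
    by (simp only: has_bochner_integral_integral_eq[OF hb[of s], symmetric] integral_mult_right_zero)
  have wc: "continuous_on UNIV (\<lambda>\<sigma>. 1 / G \<sigma> ^ 3)"
    using Gpos by (intro continuous_intros Gc) (metis less_irrefl power_eq_0_iff)
  have wn: "1 / G \<sigma> ^ 3 \<ge> 0" for \<sigma>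
    using Gpos[of \<sigma>] by simp
  note der = integral_abs_kernel_derivatives[OF wc wn int eq]
  have "\<exists>a b d. \<forall>s. (G s)\<^sup>2 = a + b * s + d * s\<^sup>2"
  proof (rule pinney_square_quadratic)
    \<comment> \<open>The 2 / 3 comes from integrating a^2 over the symmetric interval, the outer 2
      from the absolute value kernel.\<close>
    show "(deriv G has_real_derivative (2 * (2 * C / 3)) / G s ^ 3) (at s)" for s
      using der(2)[of s] by simp
  qed (use der(1) Gpos in auto)
  then show ?thesis using that unfolding G_def by blast
qed

theorem theorem4p11:
  fixes K :: "(real^2) set"
  assumes "convex_body K"
    and "origin_symmetric K"
    and "C2_boundary K"
    and "homothetic (Gamma (measure lebesgue K / 2) K) (frontier (polar_body (intersection_body K)))"
  shows "is_ellipse K"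
proof -
  interpret rot90: linear rot90 by (rule linear_rot90)
  obtain C where C: "C \<ge> 0" and mem: "\<And>x. x \<in> K \<longleftrightarrow> C * abs_moment K (rot90 x) \<le> 1"
    using convex_body_sublevel_abs_moment[OF assms(1,2,4)] by blast
  have K: "compact K" using assms(1) by (simp add: convex_body_def)
  define P where "P x = C * abs_moment K (rot90 x)" for x
  have memP: "x \<in> K \<longleftrightarrow> P x \<le> 1" for x
    unfolding P_def by (rule mem)
  have scale: "P (t *\<^sub>R x) = \<bar>t\<bar> * P x" for t x
    by (simp add: P_def rot90.scale abs_moment_scaleR)
  \<comment> \<open>If \<open>P\<close> vanished at a nonzero \<open>x\<close>, the whole line
    through \<open>x\<close> and the origin would lie in the bounded set \<open>K\<close>.\<close>
  have pos: "P x > 0" if "x \<noteq> 0" for x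
  proof (rule ccontr)
    assume "\<not> P x > 0"
    moreover have "P x \<ge> 0" using C by (simp add: P_def abs_moment_nonneg)
    ultimately have "P (t *\<^sub>R x) = 0" for t by (simp add: scale)
    then have "t *\<^sub>R x \<in> K" for t by (simp add: memP)
    moreover obtain B where "\<And>y. y \<in> K \<Longrightarrow> norm y \<le> B"
      using compact_imp_bounded[OF K] by (auto simp: bounded_iff)
    ultimately have "norm (((\<bar>B\<bar> + 1) / norm x) *\<^sub>R x) \<le> B" by blast
    then show False using that by simp
  qed
  obtain a b d where abd: "\<And>s. (P (vector [1, s]))\<^sup>2 = a + b * s + d * s\<^sup>2"
    using abs_moment_slope_quadratic[OF K mem] pos unfolding P_def by blast
  define Q where "Q x = a * (x$1)\<^sup>2 + b * (x$1 * x$2) + d * (x$2)\<^sup>2" for x :: "real^2"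
  \<comment> \<open>Off the vertical axis, \<open>x\<close> is a multiple of a point (1, s), and
    homogeneity applies.\<close>
  have PQ1: "(P x)\<^sup>2 = Q x" if "x $ 1 \<noteq> 0" for x
  proof -
    have "x = x$1 *\<^sub>R vector [1, x$2 / x$1]"
      using that by (simp add: vec_eq_iff forall_2)
    then have "(P x)\<^sup>2 = (x$1)\<^sup>2 * (a + b * (x$2 / x$1) + d * (x$2 / x$1)\<^sup>2)"
      by (metis abd scale power_mult_distrib power2_abs)
    also have "\<dots> = Q x"
      using that by (simp add: Q_def power2_eq_square field_simps)
    finally show ?thesis .
  qed
  \<comment> \<open>Points on the vertical axis have no slope; they are limits of points shifted
    slightly along the first axis, and both sides are continuous.\<close>
  have PQ: "(P x)\<^sup>2 = Q x" for x
  proof -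
    have rc: "continuous_on UNIV rot90"
      using linear_rot90 by (simp add: linear_continuous_on linear_conv_bounded_linear)
    have cl: "closed {x. (P x)\<^sup>2 = Q x}"
      unfolding P_def Q_def
      by (intro closed_Collect_eq continuous_intros
          continuous_on_compose2[OF continuous_on_abs_moment[OF K] rc]) auto
    have lim: "(\<lambda>n. x + (1 / real (Suc n)) *\<^sub>R axis 1 1) \<longlonglongrightarrow> x + 0 *\<^sub>R axis 1 1"
      by (intro tendsto_intros LIMSEQ_Suc[OF lim_1_over_n])
    show ?thesis
    proof (cases "x $ 1 = 0")
      case True
      have "x + (1 / real (Suc n)) *\<^sub>R axis 1 1 \<in> {x. (P x)\<^sup>2 = Q x}" for n
        using True by (intro CollectI PQ1) (simp add: axis_def)
      from closed_sequentially[OF cl this lim] show ?thesis by simp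
    qed (rule PQ1)
  qed
  have "K = {x. Q x \<le> 1}"
  proof (intro set_eqI)
    fix x
    have "P x \<ge> 0" using C by (simp add: P_def abs_moment_nonneg)
    then have "P x \<le> 1 \<longleftrightarrow> (P x)\<^sup>2 \<le> 1" by (simp add: abs_square_le_1)
    then show "x \<in> K \<longleftrightarrow> x \<in> {x. Q x \<le> 1}" by (simp add: memP flip: PQ)
  qed
  moreover have "Q x > 0" if "x \<noteq> 0" for x
    using pos[OF that] by (simp flip: PQ)
  ultimately show ?thesis
    unfolding Q_def using is_ellipse_quadratic_sublevel by simp
qed

end
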